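(* Let $U=\{z\in\mathbb{C}:|z|<1\}$ and let $a\in B$, i.e. $a$ is an analytic function on $U$ with $|a(z)|<1$ for all $z\in U$. A function $f$ belongs to $T_{Lh}$ with respect to $a$ if and only if $f(z)=q(z)w(z)$ for $z\in U$, for some $q$ belonging to $T_{Lh}^{0}$ with respect to $a$ and some $w$ belonging to $\mathcal{P}_{Lh}$ with respect to $a$.
   Context: $\mathcal{H}(U)$ is the space of analytic functions on the unit disk $U$; $B$ is the set of analytic self-maps $a$ of $U$ ($a\in\mathcal{H}(U)$, $|a|<1$). A function $f$ on $U$ is a logharmonic mapping with respect to $a\in B$ (and $a$ is its second dilatation) if $\overline{\left(f_{\overline z}/f\right)}=a\,f_z/f$ in $U$ (where $f\neq 0$). An analytic function $\varphi$ in $U$ is typically real if $\varphi(z)$ is real whenever $z\in U$ is real and $\varphi(z)$ is nonreal for all other $z\in U$. $HG$ is the class of analytic functions $\varphi(z)=zh(z)g(z)$ on $U$, where $h,g\in\mathcal{H}(U)$, $h(0)=1=g(0)$, and $0\notin (hg)(U)$. $T_{Lh}$ is the class of logharmonic mappings $f(z)=zh(z)\overline{g(z)}$ in $U$ (with respect to some $a\in B$) such that $\varphi(z)=zh(z)g(z)\in HG$ and $\varphi$ is typically real in $U$. "$f\in T_{Lh}$ with respect to $a$" means that $f$ is in this class and is logharmonic with respect to the given $a$. $T_{Lh}^{0}$ is the subclass of $T_{Lh}$ consisting of mappings $q(z)=zu(z)\overline{v(z)}$, logharmonic with respect to $a\in B$, satisfying $zu(z)v(z)=z/(1-z^2)$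 (with $u,v\in\mathcal{H}(U)$, $u(0)=1=v(0)$). $\mathcal{P}_{\mathbb{R}}$ is the class of analytic functions $p$ on $U$ with $p(0)=1$, $\operatorname{Re}p>0$ in $U$, and real Taylor coefficients at $0$. $\mathcal{P}_{Lh}$ is the class of mappings $w(z)=s(z)\overline{t(z)}$, logharmonic with respect to $a\in B$, where $s,t\in\mathcal{H}(U)$, $s(0)=1=t(0)$, and $p(z)=s(z)t(z)\in\mathcal{P}_{\mathbb{R}}$. *)

theory Defs
  imports "HOL-Analysis.Analysis"
begin

(* Functions on the unit disk are total functions complex => complex of which only
   the values on the disk matter. *)

abbreviation unit_disk :: "complex set" where
  "unit_disk \<equiv> ball 0 1"

definition disk_self_maps :: "(complex \<Rightarrow> complex) set" where
  "disk_self_maps = {a. a holomorphic_on unit_disk \<and> (\<forall>z\<in>unit_disk. cmod (a z) < 1)}"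

(* Wirtinger derivatives (f_x - i f_y) / 2 and (f_x + i f_y) / 2, where f_x and f_y are the
   values of the real Frechet derivative in the directions 1 and i. *)

definition wirtinger_z :: "(complex \<Rightarrow> complex) \<Rightarrow> complex \<Rightarrow> complex" where
  "wirtinger_z f z = (frechet_derivative f (at z) 1 - \<i> * frechet_derivative f (at z) \<i>) / 2"

definition wirtinger_zbar :: "(complex \<Rightarrow> complex) \<Rightarrow> complex \<Rightarrow> complex" where
  "wirtinger_zbar f z = (frechet_derivative f (at z) 1 + \<i> * frechet_derivative f (at z) \<i>) / 2"

(* Differentiability is over the reals; it is what gives the Wirtinger derivatives meaning. *)

definition logharmonic_wrt :: "(complex \<Rightarrow> complex) \<Rightarrow> (complex \<Rightarrow> complex) \<Rightarrow> bool" where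
  "logharmonic_wrt a f \<longleftrightarrow>
     a \<in> disk_self_maps \<and>
     (\<forall>z\<in>unit_disk. f differentiable (at z)) \<and>
     (\<forall>z\<in>unit_disk. f z \<noteq> 0 \<longrightarrow>
        cnj (wirtinger_zbar f z / f z) = a z * wirtinger_z f z / f z)"

definition typically_real :: "(complex \<Rightarrow> complex) \<Rightarrow> bool" where
  "typically_real \<phi> \<longleftrightarrow>
     \<phi> holomorphic_on unit_disk \<and> (\<forall>z\<in>unit_disk. \<phi> z \<in> \<real> \<longleftrightarrow> z \<in> \<real>)"

definition HG :: "(complex \<Rightarrow> complex) set" where
  "HG = {\<phi>. \<exists>h g. h holomorphic_on unit_disk \<and> g holomorphic_on unit_disk \<and>
     h 0 = 1 \<and> g 0 = 1 \<and> (\<forall>z\<in>unit_disk. h z * g z \<noteq> 0) \<and>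
     (\<forall>z\<in>unit_disk. \<phi> z = z * h z * g z)}"

definition T_Lh :: "(complex \<Rightarrow> complex) set" where
  "T_Lh = {f. (\<exists>a. logharmonic_wrt a f) \<and>
     (\<exists>h g. h holomorphic_on unit_disk \<and> g holomorphic_on unit_disk \<and>
        h 0 = 1 \<and> g 0 = 1 \<and>
        (\<forall>z\<in>unit_disk. f z = z * h z * cnj (g z)) \<and>
        (\<lambda>z. z * h z * g z) \<in> HG \<and>
        typically_real (\<lambda>z. z * h z * g z))}"

definition T_Lh0 :: "(complex \<Rightarrow> complex) set" where
  "T_Lh0 = {q \<in> T_Lh. \<exists>u v. u holomorphic_on unit_disk \<and> v holomorphic_on unit_disk \<and>
     u 0 = 1 \<and> v 0 = 1 \<and>
     (\<forall>z\<in>unit_disk. q z = z * u z * cnj (v z)) \<and>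
     (\<forall>z\<in>unit_disk. z * u z * v z = z / (1 - z\<^sup>2))}"

definition P_R :: "(complex \<Rightarrow> complex) set" where
  "P_R = {p. p holomorphic_on unit_disk \<and> p 0 = 1 \<and>
     (\<forall>z\<in>unit_disk. Re (p z) > 0) \<and> (\<forall>n. (deriv ^^ n) p 0 / fact n \<in> \<real>)}"

definition P_Lh :: "(complex \<Rightarrow> complex) set" where
  "P_Lh = {w. (\<exists>a. logharmonic_wrt a w) \<and>
     (\<exists>s t. s holomorphic_on unit_disk \<and> t holomorphic_on unit_disk \<and>
        s 0 = 1 \<and> t 0 = 1 \<and>
        (\<forall>z\<in>unit_disk. w z = s z * cnj (t z)) \<and>
        (\<lambda>z. s z * t z) \<in> P_R)}"

end

theory Submission
  imports Defs "HOL-Complex_Analysis.Complex_Analysis"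
begin

text \<open>
  For \<open>f = F * cnj G\<close> with \<open>F\<close> and \<open>G\<close> holomorphic, the logharmonic equation says that
  \<open>F * G' = a * F' * G\<close> wherever \<open>f\<close> does not vanish. In logarithmic derivatives this is
  \<open>G'/G = a * F'/F\<close>, so for a fixed dilatation \<open>a\<close> the pairs \<open>(F, G)\<close> that satisfy it are closed
  under products and quotients (\<open>dilatation_relation_mult_iff\<close>). Hence the logharmonic part of the
  theorem is purely multiplicative, and all its function theory sits in the products \<open>F * G\<close>: for
  \<open>f = q * w\<close> these satisfy \<open>\<phi> z = z / (1 - z\<^sup>2) * p z\<close>, and Rogosinski's theorem says that the
  normalized \<open>\<phi>\<close> is typically real exactly when \<open>p\<close> is in \<open>P_R\<close>.

  Rogosinski's theorem is used in both directions. If \<open>\<phi>\<close> is typically real, then \<open>Im (\<phi> z)\<close> has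
  the sign of \<open>Im z\<close>. On the unit circle \<open>(1 - z\<^sup>2) / z = - 2 * \<i> * Im z\<close>, so the real part of
  \<open>(1 - z\<^sup>2) * \<phi> (r * z) / (r * z)\<close> is nonnegative there, hence by the maximum principle on the whole
  disk, and \<open>r\<close> tends to 1 (\<open>typically_real_imp_P_R\<close>). Conversely, the Schwarz-Pick inequality for
  \<open>p\<close> at the two points \<open>z\<close> and \<open>cnj z\<close>, where \<open>p (cnj z) = cnj (p z)\<close>, bounds the argument of
  \<open>p z\<close> tightly enough that \<open>z / (1 - z\<^sup>2) * p z\<close> cannot become real
  (\<open>typically_real_odd_Koebe_times_P_R\<close>).

  To split a given \<open>f\<close>, it remains to find \<open>q = z * u * cnj v\<close> with dilatation \<open>a\<close> and
  \<open>z * u * v = z / (1 - z\<^sup>2)\<close>. These conditions prescribe \<open>v'/v\<close> as \<open>a / (1 + a)\<close> times the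
  logarithmic derivative of \<open>z / (1 - z\<^sup>2)\<close>, whose pole at 0 is cancelled because the existence of
  \<open>f\<close> forces \<open>a 0 = 0\<close>; integrating and exponentiating gives \<open>v\<close>
  (\<open>odd_Koebe_logharmonic_factors\<close>). The factor \<open>w\<close> is then the quotient of \<open>f\<close> by \<open>q\<close>.
\<close>

section \<open>The logharmonic equation as a relation between holomorphic factors\<close>

text \<open>The equation \<open>G'/G = a * F'/F\<close> cleared of denominators, so that it stays meaningful, and
  passes to limits, where \<open>F\<close> or \<open>G\<close> vanishes.\<close>

definition dilatation_relation ::
  "(complex \<Rightarrow> complex) \<Rightarrow> (complex \<Rightarrow> complex) \<Rightarrow> (complex \<Rightarrow> complex) \<Rightarrow> complex \<Rightarrow> bool" where
  "dilatation_relation a F G z \<longleftrightarrow> F z * deriv G z = a z * deriv F z * G z"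

lemma dilatation_relation_cong:
  assumes "open A" "z \<in> A" "\<And>w. w \<in> A \<Longrightarrow> F w = F' w" "\<And>w. w \<in> A \<Longrightarrow> G w = G' w"
  shows "dilatation_relation a F G z \<longleftrightarrow> dilatation_relation a F' G' z"
proof -
  have "\<forall>\<^sub>F w in nhds z. F w = F' w" "\<forall>\<^sub>F w in nhds z. G w = G' w"
    using assms by (auto simp: eventually_nhds)
  then have "deriv F z = deriv F' z" "deriv G z = deriv G' z"
    by (auto intro: deriv_cong_ev)
  then show ?thesis
    using assms by (simp add: dilatation_relation_def)
qed

lemma wirtinger_mult_cnj:
  assumes F: "F holomorphic_on S" and G: "G holomorphic_on S"
    and S: "open S" "z \<in> S" and f: "\<And>w. w \<in> S \<Longrightarrow> f w = F w * cnj (G w)"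
  shows "f differentiable (at z)"
    and "wirtinger_z f z = deriv F z * cnj (G z)"
    and "wirtinger_zbar f z = F z * cnj (deriv G z)"
proof -
  let ?D = "\<lambda>x. F z * cnj (deriv G z * x) + (deriv F z * x) * cnj (G z)"
  have "(F has_derivative (*) (deriv F z)) (at z)" "(G has_derivative (*) (deriv G z)) (at z)"
    using F G S holomorphic_derivI has_field_derivative_imp_has_derivative by blast+
  then have "((\<lambda>w. F w * cnj (G w)) has_derivative ?D) (at z)"
    by (intro has_derivative_mult has_derivative_cnj)
  then have D: "(f has_derivative ?D) (at z)"
    by (rule has_derivative_transform_within_open[OF _ S]) (simp add: f)
  then show "f differentiable (at z)"
    by (auto simp: differentiable_def)
  have fd: "frechet_derivative f (at z) = ?D"
    using frechet_derivative_at[OF D] by simp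
  show "wirtinger_z f z = deriv F z * cnj (G z)"
    by (simp add: wirtinger_z_def fd algebra_simps)
  show "wirtinger_zbar f z = F z * cnj (deriv G z)"
    by (simp add: wirtinger_zbar_def fd algebra_simps)
qed

lemma logharmonic_wrt_mult_cnj_iff:
  assumes F: "F holomorphic_on unit_disk" and G: "G holomorphic_on unit_disk"
    and f: "\<And>w. w \<in> unit_disk \<Longrightarrow> f w = F w * cnj (G w)"
  shows "logharmonic_wrt a f \<longleftrightarrow> a \<in> disk_self_maps \<and>
    (\<forall>z\<in>unit_disk. F z \<noteq> 0 \<longrightarrow> G z \<noteq> 0 \<longrightarrow> dilatation_relation a F G z)"
proof -
  have "cnj (wirtinger_zbar f z / f z) = a z * wirtinger_z f z / f z \<longleftrightarrow> dilatation_relation a F G z"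
    if z: "z \<in> unit_disk" and nz: "F z \<noteq> 0" "G z \<noteq> 0" for z
  proof -
    have W: "wirtinger_z f z = deriv F z * cnj (G z)" "wirtinger_zbar f z = F z * cnj (deriv G z)"
      using wirtinger_mult_cnj(2,3)[OF F G open_ball z] f by blast+
    show ?thesis
      unfolding W f[OF z] dilatation_relation_def using nz by (auto simp: field_simps)
  qed
  then show ?thesis
    using wirtinger_mult_cnj(1)[OF F G open_ball _ f] f
    unfolding logharmonic_wrt_def by auto
qed

text \<open>Logarithmic derivatives of products add up. The equivalence serves both for multiplying two
  logharmonic maps and for dividing one by another.\<close>

lemma dilatation_relation_mult_iff:
  assumes hol: "F holomorphic_on A" "G holomorphic_on A" "s holomorphic_on A" "t holomorphic_on A"
    and A: "open A" "z \<in> A" and nz: "F z \<noteq> 0" "G z \<noteq> 0" and rel: "dilatation_relation a F G z"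
  shows "dilatation_relation a (\<lambda>w. F w * s w) (\<lambda>w. G w * t w) z \<longleftrightarrow> dilatation_relation a s t z"
proof -
  have d: "deriv (\<lambda>w. F w * s w) z = F z * deriv s z + deriv F z * s z"
    "deriv (\<lambda>w. G w * t w) z = G z * deriv t z + deriv G z * t z"
    using hol A by (auto intro!: deriv_mult holomorphic_on_imp_differentiable_at)
  have "F z * s z * (G z * deriv t z + deriv G z * t z)
        - a z * (F z * deriv s z + deriv F z * s z) * (G z * t z)
      = F z * G z * (s z * deriv t z - a z * deriv s z * t z)
        + s z * t z * (F z * deriv G z - a z * deriv F z * G z)"
    by (simp add: algebra_simps)
  also have "\<dots> = F z * G z * (s z * deriv t z - a z * deriv s z * t z)"
    using rel by (simp add: dilatation_relation_def)
  finally show ?thesis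
    using nz unfolding dilatation_relation_def d
    by (metis eq_iff_diff_eq_0 mult_eq_0_iff)
qed

text \<open>At a zero of \<open>f\<close> the logharmonic equation says nothing, but its holomorphic form persists there by
  continuity.\<close>

lemma dilatation_relation_at_zero:
  assumes hol: "a holomorphic_on unit_disk" "F holomorphic_on unit_disk" "G holomorphic_on unit_disk"
    and rel: "\<And>z. z \<in> unit_disk - {0} \<Longrightarrow> dilatation_relation a F G z"
  shows "dilatation_relation a F G 0"
proof -
  let ?E = "\<lambda>z. F z * deriv G z - a z * deriv F z * G z"
  have "?E holomorphic_on unit_disk"
    using hol by (auto intro!: holomorphic_intros)
  then have lim: "?E \<midarrow>0\<rightarrow> ?E 0"
    using continuous_on_interior[OF holomorphic_on_imp_continuous_on, of ?E unit_disk 0]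
    unfolding isCont_def by simp
  have "\<forall>\<^sub>F z in at 0. z \<in> unit_disk - {0}"
    using eventually_at_in_open[of unit_disk 0] by simp
  then have "\<forall>\<^sub>F z in at 0. ?E z = 0"
    by (rule eventually_mono) (use rel in \<open>simp add: dilatation_relation_def\<close>)
  then have "?E \<midarrow>0\<rightarrow> 0"
    by (rule tendsto_eventually)
  then have "?E 0 = 0"
    using lim by (rule LIM_unique[rotated])
  then show ?thesis
    by (simp add: dilatation_relation_def)
qed

text \<open>At the zero of \<open>z * h z\<close> the left-hand side of the relation vanishes, while the right-hand side is
  \<open>a 0 * h 0 * g 0\<close>; a simple zero at the origin therefore forces the dilatation to vanish there.\<close>

lemma logharmonic_at_simple_zero:
  assumes h: "h holomorphic_on unit_disk" and g: "g holomorphic_on unit_disk"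
    and h0: "h 0 = 1" and g0: "g 0 = 1"
    and nz: "\<And>z. z \<in> unit_disk \<Longrightarrow> h z * g z \<noteq> 0"
    and f: "\<And>z. z \<in> unit_disk \<Longrightarrow> f z = z * h z * cnj (g z)" and lh: "logharmonic_wrt a f"
  shows "\<And>z. z \<in> unit_disk \<Longrightarrow> dilatation_relation a (\<lambda>z. z * h z) g z" and "a 0 = 0"
proof -
  have F: "(\<lambda>z. z * h z) holomorphic_on unit_disk"
    using h by (intro holomorphic_intros)
  have rel: "dilatation_relation a (\<lambda>z. z * h z) g z" if "z \<in> unit_disk - {0}" for z
    using logharmonic_wrt_mult_cnj_iff[OF F g f, of a] lh nz that by auto
  have a: "a holomorphic_on unit_disk"
    using lh by (simp add: logharmonic_wrt_def disk_self_maps_def)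
  have rel0: "dilatation_relation a (\<lambda>z. z * h z) g 0"
    by (rule dilatation_relation_at_zero[OF a F g rel])
  show "dilatation_relation a (\<lambda>z. z * h z) g z" if "z \<in> unit_disk" for z
    using rel rel0 that by (cases "z = 0") auto
  have "(h has_field_derivative deriv h 0) (at 0)"
    using h by (intro holomorphic_derivI) auto
  then have "((\<lambda>z. z * h z) has_field_derivative 1) (at 0)"
    using h0 by (auto intro!: derivative_eq_intros)
  then have "deriv (\<lambda>z. z * h z) 0 = 1"
    by (rule DERIV_imp_deriv)
  then show "a 0 = 0"
    using rel0 g0 by (simp add: dilatation_relation_def)
qed

section \<open>Functions with positive real part\<close>

text \<open>The derivative is a limit of difference quotients along the real axis, and these are real.\<close>

lemma deriv_real_on_reals:
  assumes f: "f holomorphic_on unit_disk" and real: "\<And>x. \<bar>x\<bar> < 1 \<Longrightarrow> f (complex_of_real x) \<in> \<real>"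
    and x: "\<bar>x\<bar> < 1"
  shows "deriv f (complex_of_real x) \<in> \<real>"
proof -
  have "(\<lambda>h. (f (of_real x + h) - f (of_real x)) / h) \<midarrow>0\<rightarrow> deriv f (of_real x)"
    using f x by (intro DERIV_D holomorphic_derivI[OF f]) auto
  moreover have "filterlim complex_of_real (at 0) (at 0)"
    by (rule filterlim_atI) (auto intro!: tendsto_eq_intros simp: eventually_at_filter)
  ultimately have lim: "((\<lambda>t. (f (of_real x + of_real t) - f (of_real x)) / of_real t)
      \<longlongrightarrow> deriv f (of_real x)) (at (0::real))"
    by (rule filterlim_compose)
  have "\<forall>\<^sub>F t in at (0::real). \<bar>t\<bar> < 1 - \<bar>x\<bar>"
    using x by (auto simp: eventually_at dist_real_def intro!: exI[of _ "1 - \<bar>x\<bar>"])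
  then have "\<forall>\<^sub>F t in at (0::real). (f (of_real x + of_real t) - f (of_real x)) / of_real t \<in> \<real>"
  proof eventually_elim
    case (elim t)
    then have "f (of_real (x + t)) \<in> \<real>" "f (of_real x) \<in> \<real>"
      using x by (auto intro!: real simp del: of_real_add)
    then show ?case by auto
  qed
  then show ?thesis
    by (rule Lim_in_closed_set[OF closed_complex_Reals _ _ lim]) simp
qed

lemma higher_deriv_real_on_reals:
  assumes "f holomorphic_on unit_disk" "\<And>x. \<bar>x\<bar> < 1 \<Longrightarrow> f (complex_of_real x) \<in> \<real>" "\<bar>x\<bar> < 1"
  shows "(deriv ^^ n) f (complex_of_real x) \<in> \<real>"
  using assms(3)
proof (induction n arbitrary: x)
  case 0
  then show ?case using assms(2) by simp
next
  case (Suc n)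
  then show ?case
    using deriv_real_on_reals[OF holomorphic_higher_deriv[OF assms(1) open_ball]] by simp
qed

text \<open>Conjugating the power series at 0 only conjugates the variable, as its coefficients are real.\<close>

lemma P_R_cnj:
  assumes p: "p \<in> P_R" and z: "z \<in> unit_disk"
  shows "p (cnj z) = cnj (p z)"
proof -
  have hol: "p holomorphic_on unit_disk" and re: "\<And>n. (deriv ^^ n) p 0 / fact n \<in> \<real>"
    using p by (auto simp: P_R_def)
  let ?c = "\<lambda>n. (deriv ^^ n) p 0 / fact n"
  have "(\<lambda>n. ?c n * z ^ n) sums p z"
    using holomorphic_power_series[OF hol z] by simp
  then have "(\<lambda>n. cnj (?c n * z ^ n)) sums cnj (p z)"
    by (simp only: sums_cnj)
  moreover have "cnj (?c n * z ^ n) = ?c n * cnj z ^ n" for n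
    using re[of n] by (simp only: complex_cnj_mult complex_cnj_power Reals_cnj_iff)
  ultimately have "(\<lambda>n. ?c n * cnj z ^ n) sums cnj (p z)"
    by (simp only:)
  moreover have "(\<lambda>n. ?c n * cnj z ^ n) sums p (cnj z)"
    using holomorphic_power_series[OF hol, of "cnj z"] z by simp
  ultimately show ?thesis
    by (rule sums_unique2[symmetric])
qed

lemma one_in_P_R: "(\<lambda>z. 1) \<in> P_R"
proof -
  have "(deriv ^^ n) (\<lambda>z. 1) (complex_of_real 0) \<in> \<real>" for n
    by (rule higher_deriv_real_on_reals) auto
  then show ?thesis
    by (auto simp: P_R_def intro: Reals_divide fact_in_Reals)
qed

lemma norm_Cayley_less_1:
  fixes x c :: complex
  assumes "Re x > 0" "Re c > 0"
  shows "norm ((x - c) / (x + cnj c)) < 1"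
proof -
  have "(norm (x + cnj c))\<^sup>2 - (norm (x - c))\<^sup>2 = 4 * Re x * Re c"
    unfolding cmod_power2 by (simp add: power2_eq_square algebra_simps)
  then have "(norm (x - c))\<^sup>2 < (norm (x + cnj c))\<^sup>2"
    using mult_pos_pos[OF assms] by linarith
  then have "norm (x - c) < norm (x + cnj c)"
    by (rule power_less_imp_less_base) simp
  then show ?thesis
    by (simp add: norm_divide divide_less_eq_1)
qed

text \<open>The Schwarz lemma for the map that results from moving \<open>w\<close> to the centre of the disk and sending
  the half plane to the disk by the Cayley transform centred at \<open>p w\<close>.\<close>

lemma Schwarz_Pick_right_half_plane:
  assumes p: "p holomorphic_on unit_disk" and pos: "\<And>z. z \<in> unit_disk \<Longrightarrow> Re (p z) > 0"
    and z: "z \<in> unit_disk" and w: "w \<in> unit_disk"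
  shows "norm ((p z - p w) / (p z + cnj (p w))) \<le> norm ((z - w) / (1 - cnj w * z))"
proof -
  define M where "M = Moebius_function 0 (- w)"
  define F where "F \<zeta> = (p (M \<zeta>) - p w) / (p (M \<zeta>) + cnj (p w))" for \<zeta>
  define \<zeta> where "\<zeta> = Moebius_function 0 w z"
  have M_disk: "M x \<in> unit_disk" if "x \<in> unit_disk" for x
    using that w Moebius_function_norm_lt_1[of "- w" x 0] by (simp add: M_def)
  have M_hol: "M holomorphic_on unit_disk"
    unfolding M_def using w by (intro Moebius_function_holomorphic) simp
  have pM: "(p \<circ> M) holomorphic_on unit_disk"
    using M_disk by (intro holomorphic_on_compose_gen[OF M_hol p]) auto
  have nz: "p (M x) + cnj (p w) \<noteq> 0" if "x \<in> unit_disk" for x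
  proof
    assume "p (M x) + cnj (p w) = 0"
    then have "Re (p (M x)) + Re (p w) = 0"
      by (metis cnj.sel(1) plus_complex.sel(1) zero_complex.sel(1))
    then show False
      using pos[OF M_disk[OF that]] pos[OF w] by linarith
  qed
  have "F holomorphic_on unit_disk"
    unfolding F_def using pM nz by (intro holomorphic_intros) (auto simp: o_def)
  moreover have "F 0 = 0"
    by (simp add: F_def M_def Moebius_function_of_zero)
  moreover have "norm (F x) < 1" if "norm x < 1" for x
    unfolding F_def using that by (intro norm_Cayley_less_1 pos M_disk w) simp
  moreover have "norm \<zeta> < 1"
    unfolding \<zeta>_def using z w by (intro Moebius_function_norm_lt_1) auto
  ultimately have "norm (F \<zeta>) \<le> norm \<zeta>"
    by (rule Schwarz_Lemma(1))
  moreover have "M \<zeta> = z"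
    unfolding M_def \<zeta>_def using z w by (intro Moebius_function_compose) auto
  ultimately show ?thesis
    by (simp add: F_def \<zeta>_def Moebius_function_simple)
qed

section \<open>Rogosinski's representation of typically real functions\<close>

lemma one_minus_square_nonzero:
  fixes z :: complex
  assumes "z \<in> unit_disk"
  shows "1 - z\<^sup>2 \<noteq> 0"
proof
  assume "1 - z\<^sup>2 = 0"
  then have "norm z ^ 2 = 1"
    by (metis eq_iff_diff_eq_0 norm_one norm_power)
  then have "norm z = 1"
    by (metis norm_ge_zero norm_one one_power2 power2_eq_imp_eq)
  with assms show False
    by simp
qed

lemma typically_real_cong:
  assumes "\<And>z. z \<in> unit_disk \<Longrightarrow> \<phi> z = \<psi> z"
  shows "typically_real \<phi> \<longleftrightarrow> typically_real \<psi>"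
proof -
  have "\<phi> holomorphic_on unit_disk \<longleftrightarrow> \<psi> holomorphic_on unit_disk"
    by (rule holomorphic_cong) (simp_all add: assms)
  then show ?thesis
    by (simp add: typically_real_def assms)
qed

text \<open>The hyperbolic distance from \<open>p z\<close> to its conjugate is at most that from \<open>z\<close> to \<open>cnj z\<close>, which in
  the coordinates below reads \<open>\<bar>J\<bar> * A \<le> 2 * \<bar>Y\<bar> * R\<close>. The argument of \<open>z / (1 - z\<^sup>2)\<close> is that of
  \<open>X * A + \<i> * Y * (1 + X\<^sup>2 + Y\<^sup>2)\<close>. A real product would then give
  \<open>1 + X\<^sup>2 + Y\<^sup>2 \<le> 2 * \<bar>X\<bar>\<close>, which is false off the real axis since \<open>(1 - \<bar>X\<bar>)\<^sup>2 + Y\<^sup>2 > 0\<close>.\<close>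

lemma odd_Koebe_times_P_R_nonreal:
  assumes p: "p \<in> P_R" and z: "z \<in> unit_disk" and y: "Im z \<noteq> 0"
  shows "Im (z / (1 - z\<^sup>2) * p z) \<noteq> 0"
proof
  assume zero: "Im (z / (1 - z\<^sup>2) * p z) = 0"
  define X Y R J A where "X = Re z" and "Y = Im z" and "R = Re (p z)" and "J = Im (p z)"
    and "A = 1 - X\<^sup>2 - Y\<^sup>2"
  note defs = X_def Y_def R_def J_def A_def
  have R: "R > 0" and hol: "p holomorphic_on unit_disk" and pos: "\<And>z. z \<in> unit_disk \<Longrightarrow> Re (p z) > 0"
    using p z by (auto simp: P_R_def R_def)
  have zbar: "cnj z \<in> unit_disk" using z by simp
  have nz: "1 - z\<^sup>2 \<noteq> 0" using one_minus_square_nonzero[OF z] .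
  have pz: "p z \<noteq> 0" using R by (auto simp: R_def)
  have "norm ((p z - cnj (p z)) / (p z + p z)) \<le> norm ((z - cnj z) / (1 - z * z))"
    using Schwarz_Pick_right_half_plane[OF hol pos z zbar] P_R_cnj[OF p z] by simp
  then have "\<bar>J\<bar> / norm (p z) \<le> 2 * \<bar>Y\<bar> / norm (1 - z\<^sup>2)"
    by (simp add: complex_diff_cnj norm_divide norm_mult defs power2_eq_square flip: mult_2)
  then have "\<bar>J\<bar> * norm (1 - z\<^sup>2) \<le> 2 * \<bar>Y\<bar> * norm (p z)"
    using nz pz by (simp add: field_simps)
  then have "(\<bar>J\<bar> * norm (1 - z\<^sup>2))\<^sup>2 \<le> (2 * \<bar>Y\<bar> * norm (p z))\<^sup>2"
    by (rule power_mono) simp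
  moreover have "(norm (1 - z\<^sup>2))\<^sup>2 = A\<^sup>2 + 4 * Y\<^sup>2"
    unfolding cmod_power2 by (simp add: defs power2_eq_square algebra_simps)
  moreover have "(norm (p z))\<^sup>2 = R\<^sup>2 + J\<^sup>2"
    by (simp add: cmod_power2 defs)
  ultimately have "J\<^sup>2 * (A\<^sup>2 + 4 * Y\<^sup>2) \<le> 4 * Y\<^sup>2 * (R\<^sup>2 + J\<^sup>2)"
    by (simp add: power_mult_distrib)
  then have angle: "J\<^sup>2 * A\<^sup>2 \<le> 4 * Y\<^sup>2 * R\<^sup>2"
    by (simp add: algebra_simps)
  have "z / (1 - z\<^sup>2) * p z = z * cnj (1 - z\<^sup>2) * p z / (norm (1 - z\<^sup>2))\<^sup>2"
    by (subst complex_div_cnj) simp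
  then have "Im (z * cnj (1 - z\<^sup>2) * p z) = 0"
    using zero nz by simp
  moreover have "Im (z * cnj (1 - z\<^sup>2) * p z) = X * A * J + Y * (1 + X\<^sup>2 + Y\<^sup>2) * R"
    by (simp add: defs power2_eq_square algebra_simps)
  ultimately have "Y * (1 + X\<^sup>2 + Y\<^sup>2) * R = - (X * A * J)"
    by linarith
  then have "(Y * (1 + X\<^sup>2 + Y\<^sup>2) * R)\<^sup>2 = X\<^sup>2 * (J\<^sup>2 * A\<^sup>2)"
    by (simp add: power_mult_distrib)
  also have "\<dots> \<le> X\<^sup>2 * (4 * Y\<^sup>2 * R\<^sup>2)"
    using angle by (intro mult_left_mono) auto
  finally have "(Y\<^sup>2 * R\<^sup>2) * (1 + X\<^sup>2 + Y\<^sup>2)\<^sup>2 \<le> (Y\<^sup>2 * R\<^sup>2) * (2 * X)\<^sup>2"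
    by (simp add: power_mult_distrib mult_ac)
  moreover have "Y\<^sup>2 * R\<^sup>2 > 0"
    using y R by (simp add: Y_def)
  ultimately have "(1 + X\<^sup>2 + Y\<^sup>2)\<^sup>2 \<le> (2 * X)\<^sup>2"
    by (simp only: mult_le_cancel_left_pos)
  then have "1 + X\<^sup>2 + Y\<^sup>2 \<le> \<bar>2 * X\<bar>"
    using abs_le_square_iff[of "1 + X\<^sup>2 + Y\<^sup>2" "2 * X"] by (simp only: abs_of_nonneg add_nonneg_nonneg zero_le_one zero_le_power2)
  moreover have "(1 - \<bar>X\<bar>)\<^sup>2 \<ge> 0" "Y\<^sup>2 > 0"
    using y by (auto simp: Y_def)
  ultimately show False
    by (simp add: power2_eq_square algebra_simps)
qed

lemma typically_real_odd_Koebe_times_P_R: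
  assumes p: "p \<in> P_R"
  shows "typically_real (\<lambda>z. z / (1 - z\<^sup>2) * p z)"
  unfolding typically_real_def
proof (intro conjI ballI iffI)
  show "(\<lambda>z. z / (1 - z\<^sup>2) * p z) holomorphic_on unit_disk"
    using p one_minus_square_nonzero by (auto intro!: holomorphic_intros simp: P_R_def)
next
  fix z :: complex assume z: "z \<in> unit_disk" and "z / (1 - z\<^sup>2) * p z \<in> \<real>"
  then show "z \<in> \<real>"
    using odd_Koebe_times_P_R_nonreal[OF p z] by (auto simp: complex_is_Real_iff)
next
  fix z :: complex assume z: "z \<in> unit_disk" and real: "z \<in> \<real>"
  then have "p z \<in> \<real>"
    using P_R_cnj[OF p z] by (metis Reals_cnj_iff)
  then show "z / (1 - z\<^sup>2) * p z \<in> \<real>"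
    using real by auto
qed

text \<open>\<open>Im (z * k z)\<close> has no zero in the open upper half disk, which is connected, and near 0 on the
  imaginary axis it has the sign of \<open>Im z\<close> because \<open>k 0 = 1\<close>; likewise for the lower half disk.\<close>

lemma typically_real_Im_sign:
  assumes k: "k holomorphic_on unit_disk" and k0: "k 0 = 1"
    and tr: "typically_real (\<lambda>z. z * k z)" and z: "z \<in> unit_disk"
  shows "Im z * Im (z * k z) \<ge> 0"
proof (cases "Im z = 0")
  case False
  let ?\<phi> = "\<lambda>z. z * k z"
  \<comment> \<open>The sign \<open>e\<close> treats both half disks at once.\<close>
  define e where "e = sgn (Im z)"
  have e: "e * Im z > 0" "e * e = 1"
    using False by (auto simp: e_def sgn_if)
  define S where "S = {w \<in> unit_disk. e * Im w > 0}"
  have "convex S"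
  proof -
    have "S = unit_disk \<inter> {w. (\<i> * of_real e) \<bullet> w > 0}"
      by (auto simp: S_def inner_complex_def)
    then show ?thesis
      by (simp add: convex_Int convex_halfspace_gt)
  qed
  moreover have "continuous_on S (\<lambda>w. e * Im (?\<phi> w))"
    using holomorphic_on_imp_continuous_on[OF k]
    by (intro continuous_intros) (auto simp: S_def intro: continuous_on_subset)
  ultimately have conn: "connected ((\<lambda>w. e * Im (?\<phi> w)) ` S)"
    by (intro connected_continuous_image convex_connected)
  have "isCont k 0"
    using continuous_on_interior[OF holomorphic_on_imp_continuous_on[OF k], of 0] by simp
  then have "((\<lambda>w. Re (k w)) \<longlongrightarrow> 1) (nhds 0)"
    unfolding isCont_def tendsto_at_iff_tendsto_nhds by (auto dest: tendsto_Re simp: k0)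
  then have "\<forall>\<^sub>F w in nhds 0. Re (k w) > 0"
    by (rule order_tendstoD) simp
  then obtain d where d: "d > 0" "\<And>w. norm w < d \<Longrightarrow> Re (k w) > 0"
    by (auto simp: eventually_nhds_metric)
  define y where "y = min d 1 / 2"
  have y: "y > 0" "y < d" "y < 1"
    using d(1) by (auto simp: y_def)
  define w where "w = \<i> * complex_of_real (e * y)"
  have ae: "\<bar>e\<bar> = 1"
    using False by (auto simp: e_def sgn_if)
  have nw: "norm w = y"
    using y ae by (simp add: w_def norm_mult abs_mult)
  have "e * Im w = y" "e * Im (?\<phi> w) = y * Re (k w)"
    using e(2) by (simp_all add: w_def flip: mult.assoc)
  then have w: "w \<in> S" "e * Im (?\<phi> w) > 0"
    using y d(2)[of w] nw by (auto simp: S_def)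
  have zS: "z \<in> S"
    using z e by (simp add: S_def)
  have "e * Im (?\<phi> z) \<ge> 0"
  proof (rule ccontr)
    assume "\<not> ?thesis"
    then have "0 \<in> (\<lambda>w. e * Im (?\<phi> w)) ` S"
      using w zS by (intro connectedD_interval[OF conn, of "e * Im (?\<phi> z)" "e * Im (?\<phi> w)" 0]) auto
    then obtain x where x: "x \<in> S" "e * Im (?\<phi> x) = 0"
      by auto
    then have "?\<phi> x \<in> \<real>"
      using e(1) by (auto simp: complex_is_Real_iff)
    then have "x \<in> \<real>"
      using tr x(1) by (auto simp: typically_real_def S_def)
    then show False
      using x(1) by (auto simp: S_def complex_is_Real_iff)
  qed
  then have "(e * Im z) * (e * Im (?\<phi> z)) \<ge> 0"
    using e(1) by simp
  also have "(e * Im z) * (e * Im (?\<phi> z)) = (e * e) * (Im z * Im (?\<phi> z))"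
    by (simp only: mult_ac)
  finally show ?thesis
    using e(2) by simp
qed simp

text \<open>The dilation by \<open>r < 1\<close> makes the function holomorphic up to the unit circle, where
  \<open>1 - w\<^sup>2 = - 2 * \<i> * Im w * w\<close> turns its real part into a positive multiple of
  \<open>Im (r * w) * Im (r * w * k (r * w))\<close>. The maximum principle carries the sign to the interior.\<close>

lemma typically_real_dilate_Re_nonneg:
  assumes k: "k holomorphic_on unit_disk" and k0: "k 0 = 1"
    and tr: "typically_real (\<lambda>z. z * k z)" and r: "0 < r" "r < 1" and z: "z \<in> cball 0 1"
  shows "Re ((1 - z\<^sup>2) * k (of_real r * z)) \<ge> 0"
proof -
  let ?P = "\<lambda>w. - ((1 - w\<^sup>2) * k (of_real r * w))"
  have sub: "of_real r * w \<in> unit_disk" if "w \<in> cball 0 1" for w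
  proof -
    have "r * norm w \<le> r"
      using that r by (intro mult_left_le) auto
    then have "norm (of_real r * w) \<le> r"
      using r by (simp only: norm_mult norm_of_real abs_of_pos)
    then show ?thesis
      using r by (simp only: mem_ball_0)
  qed
  have "((\<lambda>w. k (of_real r * w)) holomorphic_on cball 0 1)"
    using sub by (intro holomorphic_on_compose_gen[OF _ k, unfolded o_def] holomorphic_intros) auto
  then have hol: "?P holomorphic_on cball 0 1"
    by (intro holomorphic_intros)
  have "Re (?P z) \<le> 0"
  proof (rule maximum_real_frontier[where f = ?P and S = "cball 0 1" and \<xi> = z])
    show "?P holomorphic_on interior (cball 0 1)"
      using hol by (rule holomorphic_on_subset) simp
    show "continuous_on (closure (cball 0 1)) ?P"
      using holomorphic_on_imp_continuous_on[OF hol] by simp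
  next
    fix w :: complex assume "w \<in> frontier (cball 0 1)"
    then have nw: "norm w = 1" by simp
    then have wd: "of_real r * w \<in> unit_disk" using sub by simp
    have "w * cnj w = 1"
      using nw by (simp add: complex_norm_square[symmetric])
    then have "1 - w\<^sup>2 = w * (cnj w - w)"
      by (simp add: algebra_simps power2_eq_square)
    also have "cnj w - w = - 2 * \<i> * of_real (Im w)"
      by (simp add: complex_eq_iff)
    finally have "of_real r * ((1 - w\<^sup>2) * k (of_real r * w))
        = - 2 * \<i> * of_real (Im w) * (of_real r * w * k (of_real r * w))"
      by simp
    then have "Re (of_real r * ((1 - w\<^sup>2) * k (of_real r * w)))
        = Re (- 2 * \<i> * of_real (Im w) * (of_real r * w * k (of_real r * w)))"
      by (rule arg_cong)
    then have "r * Re ((1 - w\<^sup>2) * k (of_real r * w)) = 2 * Im w * Im (of_real r * w * k (of_real r * w))"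
      by simp
    then have "r * (r * Re ((1 - w\<^sup>2) * k (of_real r * w)))
        = 2 * (Im (of_real r * w) * Im (of_real r * w * k (of_real r * w)))"
      by simp
    also have "\<dots> \<ge> 0"
      using typically_real_Im_sign[OF k k0 tr wd] by linarith
    finally show "Re (?P w) \<le> 0"
      using r by (simp add: zero_le_mult_iff)
  qed (use z in auto)
  then show ?thesis by simp
qed

text \<open>If \<open>Re (p z) = 0\<close>, then \<open>exp (- p)\<close> attains its maximum modulus 1 at \<open>z\<close>, so it is
  constant; but its modulus at \<open>z0\<close> is smaller than 1.\<close>

lemma Re_nonneg_imp_Re_pos:
  assumes p: "p holomorphic_on S" and S: "open S" "connected S"
    and nonneg: "\<And>z. z \<in> S \<Longrightarrow> Re (p z) \<ge> 0" and z0: "z0 \<in> S" "Re (p z0) > 0" and z: "z \<in> S"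
  shows "Re (p z) > 0"
proof (rule ccontr)
  assume "\<not> ?thesis"
  then have zero: "Re (p z) = 0"
    using nonneg[OF z] by linarith
  have "(\<lambda>w. exp (- p w)) constant_on S"
  proof (rule maximum_modulus_principle[OF _ S S(1) order_refl z])
    show "(\<lambda>w. exp (- p w)) holomorphic_on S"
      using p by (intro holomorphic_intros)
  qed (use nonneg zero in simp)
  then have "exp (- p z) = exp (- p z0)"
    using z z0 by (auto simp: constant_on_def)
  then have "norm (exp (- p z)) = norm (exp (- p z0))"
    by simp
  then show False
    using zero z0 by simp
qed

lemma typically_real_imp_P_R:
  assumes k: "k holomorphic_on unit_disk" and k0: "k 0 = 1"
    and tr: "typically_real (\<lambda>z. z * k z)"
  shows "(\<lambda>z. (1 - z\<^sup>2) * k z) \<in> P_R"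
proof -
  let ?p = "\<lambda>z. (1 - z\<^sup>2) * k z"
  have hol: "?p holomorphic_on unit_disk"
    using k by (intro holomorphic_intros)
  have nonneg: "Re (?p z) \<ge> 0" if z: "z \<in> unit_disk" for z
  proof -
    have "isCont k z"
      using continuous_on_interior[OF holomorphic_on_imp_continuous_on[OF k], of z] z by simp
    moreover have "((\<lambda>r. of_real r * z) \<longlongrightarrow> z) (at_left (1::real))"
      by (auto intro!: tendsto_eq_intros)
    ultimately have "((\<lambda>r. k (of_real r * z)) \<longlongrightarrow> k z) (at_left (1::real))"
      by (rule isCont_tendsto_compose)
    then have "((\<lambda>r. Re ((1 - z\<^sup>2) * k (of_real r * z))) \<longlongrightarrow> Re (?p z)) (at_left (1::real))"
      by (intro tendsto_intros)
    moreover have "\<forall>\<^sub>F r in at_left (1::real). Re ((1 - z\<^sup>2) * k (of_real r * z)) \<ge> 0"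
      using eventually_at_left_real[OF zero_less_one]
      by (rule eventually_mono) (rule typically_real_dilate_Re_nonneg[OF k k0 tr], use z in auto)
    ultimately show ?thesis
      by (rule tendsto_lowerbound) simp
  qed
  have "Re (?p z) > 0" if "z \<in> unit_disk" for z
    by (rule Re_nonneg_imp_Re_pos[OF hol _ _ nonneg, of 0]) (use that k0 in auto)
  moreover have "?p (of_real x) \<in> \<real>" if x: "\<bar>x\<bar> < 1" for x
  proof (cases "x = 0")
    case False
    have "of_real x * k (of_real x) \<in> \<real>"
      using tr x by (auto simp: typically_real_def)
    then have "(of_real x * k (of_real x)) / of_real x \<in> \<real>"
      by (intro Reals_divide) auto
    then have "k (of_real x) \<in> \<real>"
      using False by simp
    then show ?thesis by auto
  qed (simp add: k0)
  then have "(deriv ^^ n) ?p 0 / fact n \<in> \<real>" for n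
    using higher_deriv_real_on_reals[OF hol, of 0 n] by (auto intro: Reals_divide fact_in_Reals)
  ultimately show ?thesis
    using hol k0 by (simp add: P_R_def)
qed

section \<open>The factorization\<close>

lemma deriv_odd_Koebe:
  fixes z :: complex
  assumes "z \<in> unit_disk"
  shows "((\<lambda>z. z / (1 - z\<^sup>2)) has_field_derivative (1 + z\<^sup>2) / (1 - z\<^sup>2)\<^sup>2) (at z)"
  using one_minus_square_nonzero[OF assms]
  by (auto intro!: derivative_eq_intros simp: divide_simps power2_eq_square algebra_simps)

text \<open>With \<open>K = z / (1 - z\<^sup>2)\<close> and \<open>F = K / v\<close>, the relation \<open>v'/v = a * F'/F = a * (K'/K - v'/v)\<close> is
  the linear equation \<open>v'/v = a / (1 + a) * K'/K\<close>. Here \<open>K'/K = (1 + z\<^sup>2) / (z * (1 - z\<^sup>2))\<close> has a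
  pole at 0 that the zero of \<open>a\<close> removes, so the right-hand side has a primitive on the disk.\<close>

lemma odd_Koebe_logharmonic_factors:
  assumes a: "a \<in> disk_self_maps" and a0: "a 0 = 0"
  obtains v where "v holomorphic_on unit_disk" "v 0 = 1" "\<And>z. v z \<noteq> 0"
    "\<And>z. z \<in> unit_disk \<Longrightarrow> dilatation_relation a (\<lambda>z. z / (1 - z\<^sup>2) / v z) v z"
proof -
  have a_hol: "a holomorphic_on unit_disk" and a_lt: "\<And>z. z \<in> unit_disk \<Longrightarrow> norm (a z) < 1"
    using a by (auto simp: disk_self_maps_def)
  have a1: "1 + a z \<noteq> 0" if "z \<in> unit_disk" for z
    using a_lt[OF that] by (metis add_eq_0_iff norm_minus_cancel norm_one less_irrefl)
  \<comment> \<open>\<open>b\<close> is \<open>a / z\<close>, and \<open>?L\<close> is \<open>a / (1 + a) * K'/K\<close> with the factor \<open>z\<close> cancelled.\<close>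
  obtain b where b: "b holomorphic_on unit_disk" "\<And>z. norm z < 1 \<Longrightarrow> a z = z * b z"
    using Schwarz3[OF a_hol a0] by metis
  let ?L = "\<lambda>z. b z * (1 + z\<^sup>2) / ((1 + a z) * (1 - z\<^sup>2))"
  have "?L holomorphic_on unit_disk"
    using a_hol b(1) a1 one_minus_square_nonzero by (intro holomorphic_intros) auto
  then obtain V where V: "\<And>z. z \<in> unit_disk \<Longrightarrow> (V has_field_derivative ?L z) (at z within unit_disk)"
    using holomorphic_convex_primitive'[OF convex_ball open_ball] by blast
  define v where "v z = exp (V z - V 0)" for z
  have dv: "(v has_field_derivative ?L z * v z) (at z)" if z: "z \<in> unit_disk" for z
    using V[OF z] z unfolding v_def
    by (auto simp: at_within_open[OF _ open_ball] intro!: derivative_eq_intros)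
  show ?thesis
  proof (rule that)
    show "v holomorphic_on unit_disk"
      using dv by (metis holomorphic_on_open open_ball)
    show "v 0 = 1" "\<And>z. v z \<noteq> 0"
      by (simp_all add: v_def)
  next
    fix z assume z: "z \<in> unit_disk"
    let ?K' = "(1 + z\<^sup>2) / (1 - z\<^sup>2)\<^sup>2"
    have v: "v z \<noteq> 0" by (simp add: v_def)
    note nz = one_minus_square_nonzero[OF z] a1[OF z] v
    have quotient: "(K' * c - K * (l * c)) / (c * c) = (K' - K * l) / c" if "c \<noteq> 0" for K' K l c :: complex
      using that by (simp add: field_simps)
    have "((\<lambda>z. z / (1 - z\<^sup>2) / v z) has_field_derivative
        (?K' * v z - z / (1 - z\<^sup>2) * (?L z * v z)) / (v z * v z)) (at z)"
      by (rule DERIV_divide[OF deriv_odd_Koebe[OF z] dv[OF z] v])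
    then have dF: "deriv (\<lambda>z. z / (1 - z\<^sup>2) / v z) z
        = (?K' - z / (1 - z\<^sup>2) * ?L z) / v z"
      using v by (simp only: DERIV_imp_deriv quotient not_False_eq_True)
    have key: "z / (1 - z\<^sup>2) * ?L z * (1 + a z) = a z * ?K'"
      using nz b(2)[of z] z by (simp add: divide_simps power2_eq_square)
    have solve: "X = A * (K - X)" if "X * (1 + A) = A * K" for X A K :: complex
      using that by (simp add: algebra_simps)
    have "z / (1 - z\<^sup>2) / v z * (?L z * v z) = z / (1 - z\<^sup>2) * ?L z"
      using v by simp
    also have "\<dots> = a z * (?K' - z / (1 - z\<^sup>2) * ?L z)"
      by (rule solve[OF key])
    also have "\<dots> = a z * ((?K' - z / (1 - z\<^sup>2) * ?L z) / v z) * v z"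
      using v by simp
    finally show "dilatation_relation a (\<lambda>z. z / (1 - z\<^sup>2) / v z) v z"
      unfolding dilatation_relation_def dF DERIV_imp_deriv[OF dv[OF z]] .
  qed
qed

text \<open>The factor \<open>q\<close> depends on \<open>a\<close> alone; \<open>w\<close> is the quotient, whose holomorphic parts \<open>h / u\<close> and
  \<open>g / v\<close> have product \<open>(1 - z\<^sup>2) * h * g\<close>.\<close>

lemma T_Lh_imp_factorization:
  assumes f: "f \<in> T_Lh" and lh: "logharmonic_wrt a f"
  obtains q w where "q \<in> T_Lh0" "logharmonic_wrt a q" "w \<in> P_Lh" "logharmonic_wrt a w"
    "\<And>z. z \<in> unit_disk \<Longrightarrow> f z = q z * w z"
proof -
  obtain h g where h: "h holomorphic_on unit_disk" "h 0 = 1" and g: "g holomorphic_on unit_disk" "g 0 = 1"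
    and fhg: "\<And>z. z \<in> unit_disk \<Longrightarrow> f z = z * h z * cnj (g z)"
    and HG: "(\<lambda>z. z * h z * g z) \<in> HG" and tr: "typically_real (\<lambda>z. z * h z * g z)"
    using f unfolding T_Lh_def by auto
  have nz: "h z * g z \<noteq> 0" if "z \<in> unit_disk" for z
  proof (cases "z = 0")
    case False
    obtain h1 g1 where "\<forall>z\<in>unit_disk. h1 z * g1 z \<noteq> 0" "\<forall>z\<in>unit_disk. z * h z * g z = z * h1 z * g1 z"
      using HG unfolding HG_def by auto
    then have "z * h z * g z \<noteq> 0"
      using that False by auto
    then show ?thesis by auto
  qed (simp add: h g)
  have a: "a \<in> disk_self_maps" and a_hol: "a holomorphic_on unit_disk"
    using lh by (auto simp: logharmonic_wrt_def disk_self_maps_def)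
  have a0: "a 0 = 0" and rel: "\<And>z. z \<in> unit_disk \<Longrightarrow> dilatation_relation a (\<lambda>z. z * h z) g z"
    using logharmonic_at_simple_zero[OF h(1) g(1) h(2) g(2) _ _ lh] nz fhg by blast+
  obtain v where v: "v holomorphic_on unit_disk" "v 0 = 1" "\<And>z. v z \<noteq> 0"
    "\<And>z. z \<in> unit_disk \<Longrightarrow> dilatation_relation a (\<lambda>z. z / (1 - z\<^sup>2) / v z) v z"
    using odd_Koebe_logharmonic_factors[OF a a0] by blast
  \<comment> \<open>As \<open>u * v = 1 / (1 - z\<^sup>2)\<close>, the function \<open>s\<close> is \<open>h / u\<close>, written without the division.\<close>
  define u where "u z = 1 / (1 - z\<^sup>2) / v z" for z
  define s where "s z = h z * (1 - z\<^sup>2) * v z" for z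
  define t where "t z = g z / v z" for z
  define q where "q z = z * u z * cnj (v z)" for z
  define w where "w z = s z * cnj (t z)" for z
  note sq = one_minus_square_nonzero
  have u: "u holomorphic_on unit_disk" "u 0 = 1"
    unfolding u_def using v sq by (auto intro!: holomorphic_intros)
  have s: "s holomorphic_on unit_disk" "s 0 = 1"
    unfolding s_def using v h by (auto intro!: holomorphic_intros)
  have t: "t holomorphic_on unit_disk" "t 0 = 1"
    unfolding t_def using v g by (auto intro!: holomorphic_intros)
  have us: "z * u z * s z = z * h z" and vt: "v z * t z = g z" if "z \<in> unit_disk" for z
    using v(3)[of z] sq[OF that] by (simp_all add: u_def s_def t_def)
  have uv: "z * u z * v z = z / (1 - z\<^sup>2)" for z
    using v(3)[of z] by (simp add: u_def)
  have zu: "(\<lambda>z. z * u z) holomorphic_on unit_disk"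
    using u by (intro holomorphic_intros)
  have "(\<lambda>z. z * u z) = (\<lambda>z. z / (1 - z\<^sup>2) / v z)"
    by (simp add: u_def)
  then have rel_uv: "dilatation_relation a (\<lambda>z. z * u z) v z" if "z \<in> unit_disk" for z
    using v(4)[OF that] by simp
  have q_lh: "logharmonic_wrt a q"
    using logharmonic_wrt_mult_cnj_iff[OF zu v(1), of q a] a rel_uv by (auto simp: q_def)
  have tr_uv: "typically_real (\<lambda>z. z * u z * v z)"
    using typically_real_odd_Koebe_times_P_R[OF one_in_P_R] by (simp add: uv)
  have u_nz: "u z * v z \<noteq> 0" if "z \<in> unit_disk" for z
    using sq[OF that] v(3)[of z] by (simp add: u_def)
  have q_HG: "(\<lambda>z. z * u z * v z) \<in> HG"
    unfolding HG_def using u v u_nz by blast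
  have q_T: "q \<in> T_Lh"
    unfolding T_Lh_def using q_lh u v q_HG tr_uv q_def by blast
  have q: "q \<in> T_Lh0"
    unfolding T_Lh0_def using q_T u v q_def uv by blast
  have rel_st_punctured: "dilatation_relation a s t z" if z: "z \<in> unit_disk - {0}" for z
  proof -
    have zd: "z \<in> unit_disk" using z by simp
    have "dilatation_relation a (\<lambda>z. z * u z * s z) (\<lambda>z. v z * t z) z"
      using rel[OF zd] by (subst dilatation_relation_cong[OF open_ball zd us vt]) simp_all
    then show ?thesis
      using dilatation_relation_mult_iff[OF zu v(1) s(1) t(1) open_ball zd] rel_uv[OF zd] u_nz[OF zd] z
      by auto
  qed
  have "dilatation_relation a s t 0"
    by (rule dilatation_relation_at_zero[OF a_hol s(1) t(1) rel_st_punctured])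
  then have rel_st: "dilatation_relation a s t z" if "z \<in> unit_disk" for z
    using rel_st_punctured that by (cases "z = 0") auto
  have w_lh: "logharmonic_wrt a w"
    using logharmonic_wrt_mult_cnj_iff[OF s(1) t(1), of w a] a rel_st by (auto simp: w_def)
  have "(\<lambda>z. (1 - z\<^sup>2) * (h z * g z)) \<in> P_R"
    using h g tr by (intro typically_real_imp_P_R) (auto intro!: holomorphic_intros simp: mult.assoc)
  moreover have "(\<lambda>z. (1 - z\<^sup>2) * (h z * g z)) = (\<lambda>z. s z * t z)"
    using v(3) by (simp add: s_def t_def fun_eq_iff)
  ultimately have st: "(\<lambda>z. s z * t z) \<in> P_R"
    by simp
  have w: "w \<in> P_Lh"
    unfolding P_Lh_def using w_lh s t st w_def by blast
  have "f z = q z * w z" if z: "z \<in> unit_disk" for z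
  proof -
    have "f z = (z * u z * s z) * cnj (v z * t z)"
      by (simp only: fhg[OF z] us[OF z] vt[OF z])
    then show ?thesis
      by (simp add: q_def w_def)
  qed
  then show thesis
    using that q q_lh w w_lh by blast
qed

lemma factorization_imp_T_Lh:
  assumes q: "q \<in> T_Lh0" "logharmonic_wrt a q" and w: "w \<in> P_Lh" "logharmonic_wrt a w"
    and f: "\<And>z. z \<in> unit_disk \<Longrightarrow> f z = q z * w z"
  shows "f \<in> T_Lh" and "logharmonic_wrt a f"
proof -
  obtain u v where u: "u holomorphic_on unit_disk" "u 0 = 1" and v: "v holomorphic_on unit_disk" "v 0 = 1"
    and quv: "\<And>z. z \<in> unit_disk \<Longrightarrow> q z = z * u z * cnj (v z)"
    and uv: "\<And>z. z \<in> unit_disk \<Longrightarrow> z * u z * v z = z / (1 - z\<^sup>2)"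
    using q(1) unfolding T_Lh0_def by blast
  obtain s t where s: "s holomorphic_on unit_disk" "s 0 = 1" and t: "t holomorphic_on unit_disk" "t 0 = 1"
    and wst: "\<And>z. z \<in> unit_disk \<Longrightarrow> w z = s z * cnj (t z)" and st: "(\<lambda>z. s z * t z) \<in> P_R"
    using w(1) unfolding P_Lh_def by blast
  let ?h = "\<lambda>z. u z * s z" and ?g = "\<lambda>z. v z * t z"
  have hg: "?h holomorphic_on unit_disk" "?g holomorphic_on unit_disk" "?h 0 = 1" "?g 0 = 1"
    using u v s t by (auto intro!: holomorphic_intros)
  have fhg: "f z = z * ?h z * cnj (?g z)" if "z \<in> unit_disk" for z
    using f[OF that] quv[OF that] wst[OF that] by simp
  have st_nz: "s z * t z \<noteq> 0" if "z \<in> unit_disk" for z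
  proof -
    have "Re (s z * t z) > 0"
      using st that unfolding P_R_def by blast
    then show ?thesis
      by (metis less_irrefl zero_complex.sel(1))
  qed
  have uv_nz: "u z * v z \<noteq> 0" if "z \<in> unit_disk" for z
  proof (cases "z = 0")
    case False
    then show ?thesis
      using uv[OF that] one_minus_square_nonzero[OF that] by auto
  qed (simp add: u v)
  have zu: "(\<lambda>z. z * u z) holomorphic_on unit_disk"
    using u by (intro holomorphic_intros)
  have F: "(\<lambda>z. z * u z * s z) holomorphic_on unit_disk"
    using zu s(1) by (rule holomorphic_on_mult)
  have a: "a \<in> disk_self_maps"
    using q(2) by (simp add: logharmonic_wrt_def)
  have "dilatation_relation a (\<lambda>z. z * u z * s z) ?g z"
    if z: "z \<in> unit_disk" and nz: "z * u z * s z \<noteq> 0" "?g z \<noteq> 0" for z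
  proof -
    have "dilatation_relation a (\<lambda>z. z * u z) v z" "dilatation_relation a s t z"
      using logharmonic_wrt_mult_cnj_iff[OF zu v(1) quv, of a] q(2)
        logharmonic_wrt_mult_cnj_iff[OF s(1) t(1) wst, of a] w(2) z nz by auto
    then show ?thesis
      using dilatation_relation_mult_iff[OF zu v(1) s(1) t(1) open_ball z] nz by auto
  qed
  then show lh: "logharmonic_wrt a f"
    using logharmonic_wrt_mult_cnj_iff[OF F hg(2), of f a] fhg a by (auto simp: mult.assoc)
  have "z * ?h z * ?g z = z / (1 - z\<^sup>2) * (s z * t z)" if "z \<in> unit_disk" for z
    by (subst uv[OF that, symmetric]) (simp only: mult_ac)
  then have tr: "typically_real (\<lambda>z. z * ?h z * ?g z)"
    using typically_real_cong[of "\<lambda>z. z * ?h z * ?g z" "\<lambda>z. z / (1 - z\<^sup>2) * (s z * t z)"]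
      typically_real_odd_Koebe_times_P_R[OF st] by blast
  have "\<forall>z\<in>unit_disk. ?h z * ?g z \<noteq> 0"
    using st_nz uv_nz by auto
  then have "(\<lambda>z. z * ?h z * ?g z) \<in> HG"
    unfolding HG_def using hg by blast
  then show "f \<in> T_Lh"
    unfolding T_Lh_def using lh hg tr fhg by blast
qed

theorem theorem1:
  fixes a f :: "complex \<Rightarrow> complex"
  assumes "a \<in> disk_self_maps"
  shows "(f \<in> T_Lh \<and> logharmonic_wrt a f) \<longleftrightarrow>
    (\<exists>q w. q \<in> T_Lh0 \<and> logharmonic_wrt a q \<and>
           w \<in> P_Lh \<and> logharmonic_wrt a w \<and>
           (\<forall>z\<in>unit_disk. f z = q z * w z))"
  by (meson T_Lh_imp_factorization factorization_imp_T_Lh)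

end
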